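(* Let $G$ be any finite simple graph with nonempty vertex set and let $\delta\in[0,1]$. Then $$R^*(G,\delta)\ \ge\ \log\frac{|V(G)|}{\chi^*(G)}+R_{GV}(\chi^*(G),\delta),$$ where $\chi^*(G)$ is the fractional chromatic number of $G$.
   Context: For a finite simple graph $G$, define $d_G$ on $V(G)$ by $d_G(v,v')=0$ if $v=v'$, $d_G(v,v')=1$ if $\{v,v'\}\in E(G)$, and $d_G(v,v')=\infty$ otherwise. Extend it additively to $V(G)^n$: $d_G(x,x')=\sum_{j=1}^n d_G(x_j,x'_j)$. For $n\ge 1$ and real $d\ge 0$, $G(n,d)$ is the simple graph with vertex set $V(G)^n$ in which distinct $x,x'$ are adjacent iff $d_G(x,x')\le d$. For real $\delta\ge 0$, $R^*(G,\delta)=\limsup_{n\to\infty}\frac1n\log\alpha(G(n,\delta n))$, where $\alpha$ denotes the size of a largest independent set. Logarithms are to a fixed base greater than $1$. The fractional chromatic number $\chi^*(G)$ is the minimum of $\sum_I w_I$ over nonnegative weights $w_I$ on the independent sets $I$ of $G$ such that $\sum_{I\ni u}w_I\ge 1$ for every vertex $u$. For real $q\ge 1$ (not necessarily an integer) and $\delta\in[0,1]$: $R_{GV}(q,\delta)=\log q-H_q(\delta)$ if $\delta<1-\frac1q$, and $R_{GV}(q,\delta)=0$ if $\delta\ge 1-\frac1q$, where $H_q(x)=x\log(q-1)-x\log x-(1-x)\log(1-x)$ with $0\log 0=0$. *)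

theory Defs
  imports "HOL-Analysis.Analysis"
begin

record 'a ugraph =
  verts :: "'a set"
  edges :: "'a set set"

definition fin_simple_graph :: "'a ugraph \<Rightarrow> bool" where
  "fin_simple_graph G \<longleftrightarrow> finite (verts G) \<and> (\<forall>e\<in>edges G. e \<subseteq> verts G \<and> card e = 2)"

definition independent_set :: "'a ugraph \<Rightarrow> 'a set \<Rightarrow> bool" where
  "independent_set G I \<longleftrightarrow> I \<subseteq> verts G \<and> (\<forall>u\<in>I. \<forall>v\<in>I. {u, v} \<notin> edges G)"

definition independence_number :: "'a ugraph \<Rightarrow> nat" where
  "independence_number G = Max (card ` {I. independent_set G I})"

subsection \<open>The distance and the graphs \<open>G(n,d)\<close>\<close>

definition gdist :: "'a ugraph \<Rightarrow> 'a \<Rightarrow> 'a \<Rightarrow> ereal" where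
  "gdist G v v' = (if v = v' then 0 else if {v, v'} \<in> edges G then 1 else \<infinity>)"

text \<open>Words of length \<open>n\<close> are functions on \<open>{1..n}\<close>, made unique by extensionality
  outside that index set.\<close>

definition words :: "'a ugraph \<Rightarrow> nat \<Rightarrow> (nat \<Rightarrow> 'a) set" where
  "words G n = {1..n} \<rightarrow>\<^sub>E verts G"

definition word_dist :: "'a ugraph \<Rightarrow> nat \<Rightarrow> (nat \<Rightarrow> 'a) \<Rightarrow> (nat \<Rightarrow> 'a) \<Rightarrow> ereal" where
  "word_dist G n x x' = (\<Sum>j=1..n. gdist G (x j) (x' j))"

definition power_graph :: "'a ugraph \<Rightarrow> nat \<Rightarrow> real \<Rightarrow> (nat \<Rightarrow> 'a) ugraph" where
  "power_graph G n d =
    \<lparr>verts = words G n,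
     edges = {{x, x'} | x x'. x \<in> words G n \<and> x' \<in> words G n \<and> x \<noteq> x'
                \<and> word_dist G n x x' \<le> ereal d}\<rparr>"

text \<open>The upper limit is taken in the extended reals, so that it exists without any
  boundedness argument; \<open>b\<close> is the base of the logarithm.\<close>

definition Rstar :: "real \<Rightarrow> 'a ugraph \<Rightarrow> real \<Rightarrow> ereal" where
  "Rstar b G \<delta> =
    limsup (\<lambda>n. ereal (1 / real n *
      log b (real (independence_number (power_graph G n (\<delta> * real n))))))"

subsection \<open>The fractional chromatic number\<close>

definition fractional_colouring :: "'a ugraph \<Rightarrow> ('a set \<Rightarrow> real) \<Rightarrow> bool" where
  "fractional_colouring G w \<longleftrightarrow>
    (\<forall>I. independent_set G I \<longrightarrow> 0 \<le> w I) \<and>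
    (\<forall>u\<in>verts G. 1 \<le> (\<Sum>I | independent_set G I \<and> u \<in> I. w I))"

definition colouring_weight :: "'a ugraph \<Rightarrow> ('a set \<Rightarrow> real) \<Rightarrow> real" where
  "colouring_weight G w = (\<Sum>I | independent_set G I. w I)"

text \<open>For a finite simple graph the infimum is a minimum, see
  \<open>fractional_chromatic_number_attained\<close> and \<open>fractional_chromatic_number_le\<close> below.\<close>

definition fractional_chromatic_number :: "'a ugraph \<Rightarrow> real" where
  "fractional_chromatic_number G = Inf (colouring_weight G ` {w. fractional_colouring G w})"

subsection \<open>The Gilbert--Varshamov function\<close>

text \<open>The convention \<open>0 log 0 = 0\<close> holds automatically, as \<open>log b x\<close> and
  \<open>log b (1 - x)\<close> carry their own argument as a factor.  At \<open>q = 1\<close> the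
  first case of \<open>R_GV\<close> is empty for \<open>\<delta> \<ge> 0\<close>, so \<open>log b (q - 1)\<close>
  is never evaluated at \<open>0\<close>.\<close>

definition entropy_q :: "real \<Rightarrow> real \<Rightarrow> real \<Rightarrow> real" where
  "entropy_q b q x = x * log b (q - 1) - x * log b x - (1 - x) * log b (1 - x)"

definition R_GV :: "real \<Rightarrow> real \<Rightarrow> real \<Rightarrow> real" where
  "R_GV b q \<delta> = (if \<delta> < 1 - 1 / q then log b q - entropy_q b q \<delta> else 0)"

subsection \<open>Attainment of the minimum\<close>

lemma finite_independent_sets:
  assumes "fin_simple_graph G"
  shows "finite {I. independent_set G I}"
proof (rule finite_subset)
  show "{I. independent_set G I} \<subseteq> Pow (verts G)"
    by (auto simp: independent_set_def)
  show "finite (Pow (verts G))"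
    using assms by (simp add: fin_simple_graph_def)
qed

lemma fin_simple_graph_power_graph:
  assumes "fin_simple_graph G"
  shows "fin_simple_graph (power_graph G n d)"
  using assms
  by (auto simp: fin_simple_graph_def power_graph_def words_def card_2_iff intro!: finite_PiE)

lemma colouring_weight_nonneg:
  "fractional_colouring G w \<Longrightarrow> 0 \<le> colouring_weight G w"
  by (auto simp: fractional_colouring_def colouring_weight_def intro!: sum_nonneg)

lemma fractional_chromatic_number_le:
  assumes "fractional_colouring G w"
  shows "fractional_chromatic_number G \<le> colouring_weight G w"
  unfolding fractional_chromatic_number_def
  using assms by (intro cInf_lower) (auto intro!: bdd_belowI[of _ 0] colouring_weight_nonneg)

lemma fractional_chromatic_number_attained:
  assumes G: "fin_simple_graph G"
  shows "\<exists>w. fractional_colouring G w \<and> colouring_weight G w = fractional_chromatic_number G"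
proof -
  let ?I = "{I. independent_set G I}"
  have finI: "finite ?I"
    using G by (rule finite_independent_sets)
  have finIu: "finite {I. independent_set G I \<and> u \<in> I}" for u
    by (rule finite_subset[OF _ finI]) auto
  define K :: "('a set \<Rightarrow> real) set" where
    "K = {w. \<forall>I. w I \<in> {0..1}} \<inter>
      (\<Inter>u\<in>verts G. {w. 1 \<le> (\<Sum>I | independent_set G I \<and> u \<in> I. w I)})"
  have "compactin (product_topology (\<lambda>_. euclidean) UNIV) (PiE UNIV (\<lambda>_::'a set. {0..1::real}))"
    by (subst compactin_PiE) auto
  then have "compact (PiE UNIV (\<lambda>_::'a set. {0..1::real}))"
    by (simp add: euclidean_product_topology)
  then have "compact {w :: 'a set \<Rightarrow> real. \<forall>I. w I \<in> {0..1}}"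
    by (simp add: PiE_UNIV_domain Pi_def)
  moreover have "closed (\<Inter>u\<in>verts G. {w :: 'a set \<Rightarrow> real.
      1 \<le> (\<Sum>I | independent_set G I \<and> u \<in> I. w I)})"
    by (intro closed_INT ballI closed_Collect_le continuous_intros)
       (simp add: continuous_on_sum)
  ultimately have "compact K"
    unfolding K_def by (rule compact_Int_closed)
  have K: "fractional_colouring G w" if "w \<in> K" for w
    using that by (auto simp: K_def fractional_colouring_def)
  have clip: "(\<lambda>I. if independent_set G I then min 1 (w I) else 0) \<in> K"
    if w: "fractional_colouring G w" for w
  proof -
    have "1 \<le> (\<Sum>I | independent_set G I \<and> u \<in> I. min 1 (w I))" if u: "u \<in> verts G" for u
    proof (cases "\<exists>J. independent_set G J \<and> u \<in> J \<and> 1 \<le> w J")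
      case True
      then obtain J where J: "independent_set G J" "u \<in> J" "1 \<le> w J"
        by blast
      have "min 1 (w J) \<le> (\<Sum>I | independent_set G I \<and> u \<in> I. min 1 (w I))"
        using J w finIu by (intro member_le_sum) (auto simp: fractional_colouring_def)
      with J show ?thesis by simp
    next
      case False
      then have "(\<Sum>I | independent_set G I \<and> u \<in> I. min 1 (w I))
          = (\<Sum>I | independent_set G I \<and> u \<in> I. w I)"
        by (intro sum.cong) (auto simp: min_def)
      with w u show ?thesis by (simp add: fractional_colouring_def)
    qed
    moreover have "(\<Sum>I | independent_set G I \<and> u \<in> I. if independent_set G I then min 1 (w I) else 0)
        = (\<Sum>I | independent_set G I \<and> u \<in> I. min 1 (w I))" for u
      by (intro sum.cong) auto
    ultimately show ?thesis
      using w by (auto simp: K_def fractional_colouring_def)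
  qed
  have clip_le: "colouring_weight G (\<lambda>I. if independent_set G I then min 1 (w I) else 0)
      \<le> colouring_weight G w" for w
    unfolding colouring_weight_def by (intro sum_mono) auto
  have "fractional_colouring G (\<lambda>_. 1)"
  proof -
    have "1 \<le> (\<Sum>I | independent_set G I \<and> u \<in> I. 1::real)" if "u \<in> verts G" for u
    proof -
      have "independent_set G {u}"
        using G that by (auto simp: independent_set_def fin_simple_graph_def)
      then have "{I. independent_set G I \<and> u \<in> I} \<noteq> {}" by blast
      with finIu[of u] have "0 < card {I. independent_set G I \<and> u \<in> I}"
        by (simp add: card_gt_0_iff)
      then show ?thesis by simp
    qed
    then show ?thesis by (simp add: fractional_colouring_def)
  qed
  then have "K \<noteq> {}" using clip by blast
  moreover have "continuous_on K (colouring_weight G)"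
    unfolding colouring_weight_def
    by (intro continuous_on_sum continuous_on_subset[OF continuous_on_product_coordinates]) auto
  ultimately obtain w where w: "w \<in> K" "\<And>v. v \<in> K \<Longrightarrow> colouring_weight G w \<le> colouring_weight G v"
    using continuous_attains_inf[OF \<open>compact K\<close>] by blast
  have "colouring_weight G w \<le> colouring_weight G v" if "fractional_colouring G v" for v
    using w(2)[OF clip[OF that]] clip_le[of v] by linarith
  with K[OF w(1)] have "fractional_chromatic_number G = colouring_weight G w"
    unfolding fractional_chromatic_number_def by (intro cInf_eq_minimum) auto
  with K[OF w(1)] show ?thesis by auto
qed

end

theory Submission
  imports Defs
begin

text \<open>Fix a fractional colouring of weight \<open>q = \<chi>\<^sup>*(G)\<close> in which every vertex is covered
  exactly once, and a largest independent set \<open>U\<close> of \<open>G(n,d)\<close>.  For independent sets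
  \<open>J\<^sub>1, \<dots>, J\<^sub>n\<close> of \<open>G\<close>, distinct words of \<open>J\<^sub>1 \<times> \<dots> \<times> J\<^sub>n\<close> are at infinite distance.  Hence
  replacing those \<open>u \<in> U\<close> with at most \<open>d\<close> indices \<open>u\<^sub>j \<notin> J\<^sub>j\<close> by \<open>J\<^sub>1 \<times> \<dots> \<times> J\<^sub>n\<close> gives
  an independent set again, and by maximality at least \<open>\<Prod>\<^sub>j |J\<^sub>j|\<close> elements are replaced.  Averaging
  over \<open>J\<^sub>j\<close> drawn independently according to the colouring gives
  \<open>(|V|/q)\<^sup>n \<le> |U| \<cdot> P(Bin(n, 1 - 1/q) \<le> d)\<close>, and Chernoff's bound for the
  binomial tail yields the Gilbert--Varshamov exponent.\<close>

section \<open>Fractional colourings that cover every vertex exactly once\<close>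

lemma independent_set_subset:
  "independent_set G I \<Longrightarrow> J \<subseteq> I \<Longrightarrow> independent_set G J"
  by (auto simp: independent_set_def)

lemma independent_set_empty: "independent_set G {}"
  by (simp add: independent_set_def)

text \<open>Moving weight from each \<open>I \<ni> v\<close> to \<open>I - {v}\<close> in a fixed proportion lowers
  the cover of \<open>v\<close> to \<open>1\<close> and changes nothing else.\<close>

lemma fractional_colouring_thin_vertex:
  assumes G: "fin_simple_graph G" and w: "fractional_colouring G w" and v: "v \<in> verts G"
  obtains w' where "fractional_colouring G w'"
    "colouring_weight G w' = colouring_weight G w"
    "(\<Sum>I | independent_set G I \<and> v \<in> I. w' I) = 1"
    "\<forall>u. u \<noteq> v \<longrightarrow>
      (\<Sum>I | independent_set G I \<and> u \<in> I. w' I) = (\<Sum>I | independent_set G I \<and> u \<in> I. w I)"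
proof -
  let ?S = "{I. independent_set G I}"
  have fin: "finite ?S" using G by (rule finite_independent_sets)
  define a where "a = (\<Sum>I | independent_set G I \<and> v \<in> I. w I)"
  have a: "1 \<le> a" using w v by (simp add: a_def fractional_colouring_def)
  \<comment> \<open>A set \<open>I\<close> containing \<open>v\<close> keeps the share 1/a of its
    weight and passes the rest to \<open>I - {v}\<close>; so a set without \<open>v\<close> receives
    from \<open>insert v I\<close>. Since a \<ge> 1, both shares are nonnegative.\<close>
  define w' where "w' I = (if v \<in> I then w I / a
     else w I + (if independent_set G (insert v I) then (1 - 1 / a) * w (insert v I) else 0))" for I
  have cover_eq: "(\<Sum>I | independent_set G I \<and> u \<in> I. f I)
      = (\<Sum>I\<in>?S. (if u \<in> I then 1 else 0) * f I)" for u and f :: "'a set \<Rightarrow> real"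
    by (rule sum.mono_neutral_cong_left) (use fin in auto)
  \<comment> \<open>The transfer is pushed onto an arbitrary test function \<open>g\<close>: the
    constant 1 then yields the total weight, and the indicator of \<open>u \<in> I\<close> the cover
    of \<open>u\<close>.\<close>
  have key: "(\<Sum>I\<in>?S. g I * w' I) =
      (\<Sum>I\<in>?S. w I * (if v \<in> I then g I / a + (1 - 1 / a) * g (I - {v}) else g I))"
    for g :: "'a set \<Rightarrow> real"
  proof -
    let ?A = "{I. independent_set G I \<and> v \<in> I}" and ?B = "{I. independent_set G I \<and> v \<notin> I}"
    have finA: "finite ?A" and finB: "finite ?B"
      by (rule finite_subset[OF _ fin]; blast)+
    have "?A \<union> ?B = ?S" "?A \<inter> ?B = {}" by blast+
    then have split: "sum f ?S = sum f ?A + sum f ?B" for f :: "'a set \<Rightarrow> real"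
      using sum.union_disjoint[OF finA finB, of f] by simp
    have "(\<Sum>I\<in>?B. g I *
          (if independent_set G (insert v I) then (1 - 1 / a) * w (insert v I) else 0))
        = (\<Sum>I | I \<in> ?B \<and> independent_set G (insert v I). g I * ((1 - 1 / a) * w (insert v I)))"
      by (rule sum.mono_neutral_cong_right) (use finB in auto)
    \<comment> \<open>Deleting \<open>v\<close> is a bijection from the independent sets containing
      \<open>v\<close> onto those that avoid \<open>v\<close> and stay independent when
      \<open>v\<close> is added.\<close>
    also have "\<dots> = (\<Sum>I\<in>?A. g (I - {v}) * ((1 - 1 / a) * w I))"
      by (rule sum.reindex_bij_witness[where i = "\<lambda>I. I - {v}" and j = "insert v"])
         (auto simp: insert_absorb intro: independent_set_subset)
    finally have move: "(\<Sum>I\<in>?B. g I *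
          (if independent_set G (insert v I) then (1 - 1 / a) * w (insert v I) else 0))
        = (\<Sum>I\<in>?A. g (I - {v}) * ((1 - 1 / a) * w I))" .
    have "(\<Sum>I\<in>?A. g I * w' I) = (\<Sum>I\<in>?A. g I * (w I / a))"
      by (intro sum.cong) (auto simp: w'_def)
    moreover have "(\<Sum>I\<in>?B. g I * w' I) =
        (\<Sum>I\<in>?B. g I * w I) + (\<Sum>I\<in>?A. g (I - {v}) * ((1 - 1 / a) * w I))"
      unfolding move[symmetric] sum.distrib[symmetric]
      by (intro sum.cong) (auto simp: w'_def distrib_left)
    moreover have "(\<Sum>I\<in>?A. w I * (if v \<in> I then g I / a + (1 - 1 / a) * g (I - {v}) else g I))
        = (\<Sum>I\<in>?A. g I * (w I / a)) + (\<Sum>I\<in>?A. g (I - {v}) * ((1 - 1 / a) * w I))"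
      unfolding sum.distrib[symmetric] by (intro sum.cong) (auto simp: algebra_simps)
    moreover have "(\<Sum>I\<in>?B. w I * (if v \<in> I then g I / a + (1 - 1 / a) * g (I - {v}) else g I))
        = (\<Sum>I\<in>?B. g I * w I)"
      by (intro sum.cong) auto
    ultimately show ?thesis unfolding split by linarith
  qed
  have total: "colouring_weight G w' = colouring_weight G w"
    using key[of "\<lambda>_. 1"] a by (simp add: colouring_weight_def cong: if_cong)
  have cover_v: "(\<Sum>I | independent_set G I \<and> v \<in> I. w' I) = 1"
  proof -
    have "(\<Sum>I | independent_set G I \<and> v \<in> I. w' I) = (\<Sum>I\<in>?S. (if v \<in> I then 1 else 0) * w I) / a"
      unfolding cover_eq key sum_divide_distrib by (rule sum.cong) auto
    also have "\<dots> = 1" using a unfolding cover_eq[symmetric] a_def[symmetric] by simp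
    finally show ?thesis .
  qed
  have cover_u: "(\<Sum>I | independent_set G I \<and> u \<in> I. w' I)
      = (\<Sum>I | independent_set G I \<and> u \<in> I. w I)" if "u \<noteq> v" for u
    unfolding cover_eq key using that by (intro sum.cong) (auto simp: algebra_simps)
  have "0 \<le> w' I" if I: "independent_set G I" for I
    using w I a by (auto simp: w'_def fractional_colouring_def)
  then have "fractional_colouring G w'"
    using w cover_v cover_u unfolding fractional_colouring_def by (metis order_refl)
  with total cover_v cover_u show thesis using that by blast
qed

text \<open>The vertices are thinned one at a time; covers already lowered to 1 survive, because
  thinning at \<open>v\<close> leaves the cover of every other vertex unchanged.\<close>

lemma fractional_colouring_exact:
  assumes G: "fin_simple_graph G" and w: "fractional_colouring G w"
  shows "\<exists>w'. fractional_colouring G w' \<and> colouring_weight G w' = colouring_weight G w \<and>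
      (\<forall>u\<in>verts G. (\<Sum>I | independent_set G I \<and> u \<in> I. w' I) = 1)"
proof -
  have "finite A \<Longrightarrow> A \<subseteq> verts G \<Longrightarrow>
      \<exists>w'. fractional_colouring G w' \<and> colouring_weight G w' = colouring_weight G w \<and>
      (\<forall>u\<in>A. (\<Sum>I | independent_set G I \<and> u \<in> I. w' I) = 1)" for A
  proof (induction A rule: finite_induct)
    case empty
    show ?case using w by (intro exI[of _ w]) simp
  next
    case (insert v A)
    have v: "v \<in> verts G" and A: "A \<subseteq> verts G" using insert.prems by simp_all
    obtain w1 where w1: "fractional_colouring G w1"
      "colouring_weight G w1 = colouring_weight G w"
      "\<forall>u\<in>A. (\<Sum>I | independent_set G I \<and> u \<in> I. w1 I) = 1"
      using insert.IH[OF A] by (elim exE conjE)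
    obtain w' where w': "fractional_colouring G w'"
      "colouring_weight G w' = colouring_weight G w1"
      "(\<Sum>I | independent_set G I \<and> v \<in> I. w' I) = 1"
      "\<forall>u. u \<noteq> v \<longrightarrow>
        (\<Sum>I | independent_set G I \<and> u \<in> I. w' I) = (\<Sum>I | independent_set G I \<and> u \<in> I. w1 I)"
      using fractional_colouring_thin_vertex[OF G w1(1) v] .
    have "\<forall>u\<in>insert v A. (\<Sum>I | independent_set G I \<and> u \<in> I. w' I) = 1"
    proof
      fix u assume "u \<in> insert v A"
      then show "(\<Sum>I | independent_set G I \<and> u \<in> I. w' I) = 1"
        using w'(3) w'(4)[rule_format, of u] w1(3)[rule_format, of u] by (cases "u = v") simp_all
    qed
    moreover have "colouring_weight G w' = colouring_weight G w" using w'(2) w1(2) by simp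
    ultimately show ?case using w'(1) by (intro exI[of _ w'] conjI)
  qed
  from this[OF _ subset_refl] show ?thesis using G by (simp add: fin_simple_graph_def)
qed

lemma one_le_colouring_weight:
  assumes G: "fin_simple_graph G" and ne: "verts G \<noteq> {}" and w: "fractional_colouring G w"
  shows "1 \<le> colouring_weight G w"
proof -
  obtain u where u: "u \<in> verts G" using ne by blast
  then have "1 \<le> (\<Sum>I | independent_set G I \<and> u \<in> I. w I)"
    using w by (simp add: fractional_colouring_def)
  also have "\<dots> \<le> colouring_weight G w"
    unfolding colouring_weight_def
    using w finite_independent_sets[OF G]
    by (intro sum_mono2) (auto simp: fractional_colouring_def)
  finally show ?thesis .
qed

section \<open>Independent sets and distances in the power graphs\<close>

lemma card_le_independence_number:
  assumes "fin_simple_graph G" "independent_set G I"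
  shows "card I \<le> independence_number G"
  unfolding independence_number_def
  using assms finite_independent_sets[OF assms(1)] by (intro Max_ge) auto

lemma independence_number_attained:
  assumes "fin_simple_graph G"
  obtains I where "independent_set G I" "card I = independence_number G"
proof -
  have "independence_number G \<in> card ` {I. independent_set G I}"
    unfolding independence_number_def
    using finite_independent_sets[OF assms] independent_set_empty by (intro Max_in) auto
  then show thesis using that by auto
qed

lemma word_dist_commute: "word_dist G n x x' = word_dist G n x' x"
  unfolding word_dist_def gdist_def by (intro sum.cong) (auto simp: insert_commute)

lemma hamming_le_word_dist:
  "ereal (real (card {j\<in>{1..n}. x j \<noteq> x' j})) \<le> word_dist G n x x'"
proof -
  have "ereal (real (card {j\<in>{1..n}. x j \<noteq> x' j})) =
      (\<Sum>j=1..n. ereal (if x j \<noteq> x' j then 1 else 0))"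
    by (simp flip: sum.inter_filter)
  also have "\<dots> \<le> word_dist G n x x'"
    unfolding word_dist_def by (intro sum_mono) (auto simp: gdist_def)
  finally show ?thesis .
qed

text \<open>At a coordinate where the words differ, the two letters are distinct members of one
  independent set, so this single term is already infinite.\<close>

lemma word_dist_PiE_independent:
  assumes J: "\<And>j. j \<in> {1..n} \<Longrightarrow> independent_set G (J j)"
    and x: "x \<in> PiE {1..n} J" and x': "x' \<in> PiE {1..n} J" and ne: "x \<noteq> x'"
  shows "word_dist G n x x' = \<infinity>"
proof -
  obtain j where j: "j \<in> {1..n}" "x j \<noteq> x' j"
    using x x' ne by (metis PiE_ext)
  then have "gdist G (x j) (x' j) = \<infinity>"
    using J[of j] x x' by (auto simp: gdist_def independent_set_def PiE_iff)
  then show ?thesis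
    unfolding word_dist_def using j by (subst sum_Pinfty) auto
qed

lemma independent_set_power_graph_iff:
  "independent_set (power_graph G n d) U \<longleftrightarrow>
    U \<subseteq> words G n \<and> (\<forall>x\<in>U. \<forall>x'\<in>U. x \<noteq> x' \<longrightarrow> ereal d < word_dist G n x x')"
proof -
  have edges: "{x, x'} \<in> edges (power_graph G n d) \<longleftrightarrow>
      x \<in> words G n \<and> x' \<in> words G n \<and> x \<noteq> x' \<and> word_dist G n x x' \<le> ereal d" for x x'
    using word_dist_commute[of G n x x'] by (auto simp: power_graph_def doubleton_eq_iff)
  have verts: "verts (power_graph G n d) = words G n"
    by (simp add: power_graph_def)
  show ?thesis
    unfolding independent_set_def edges verts by (auto simp: not_le)
qed

section \<open>Exchange, averaging and passage to the rate\<close>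

lemma prod_card_le_replaced:
  assumes G: "fin_simple_graph G" and d: "0 \<le> d"
    and U: "independent_set (power_graph G n d) U"
    and maxU: "card U = independence_number (power_graph G n d)"
    and J: "\<And>j. j \<in> {1..n} \<Longrightarrow> independent_set G (J j)"
  shows "(\<Prod>j\<in>{1..n}. card (J j)) \<le> card {u\<in>U. real (card {j\<in>{1..n}. u j \<notin> J j}) \<le> d}"
proof -
  let ?P = "PiE {1..n} J"
  let ?bad = "{u\<in>U. real (card {j\<in>{1..n}. u j \<notin> J j}) \<le> d}"
  let ?good = "{u\<in>U. d < real (card {j\<in>{1..n}. u j \<notin> J j})}"
  have H: "fin_simple_graph (power_graph G n d)"
    using G by (rule fin_simple_graph_power_graph)
  have UW: "U \<subseteq> words G n" using U by (simp add: independent_set_power_graph_iff)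
  have finW: "finite (words G n)"
    using H by (simp add: fin_simple_graph_def power_graph_def)
  have PW: "?P \<subseteq> words G n"
    unfolding words_def using J by (intro PiE_mono) (auto simp: independent_set_def)
  \<comment> \<open>A word \<open>x\<close> of the product has \<open>x j \<in> J j\<close>, so it
    differs from \<open>u\<close> at every index with \<open>u j \<notin> J j\<close>; there are
    more than \<open>d\<close> of these.\<close>
  have far: "ereal d < word_dist G n u x" "ereal d < word_dist G n x u"
    if u: "u \<in> ?good" and x: "x \<in> ?P" for u x
  proof -
    have "card {j\<in>{1..n}. u j \<notin> J j} \<le> card {j\<in>{1..n}. u j \<noteq> x j}"
      using x by (intro card_mono) (auto simp: PiE_iff)
    then have lt: "ereal d < ereal (real (card {j\<in>{1..n}. u j \<noteq> x j}))"
      using u by simp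
    also note hamming_le_word_dist
    finally show "ereal d < word_dist G n u x" .
    have "{j\<in>{1..n}. u j \<noteq> x j} = {j\<in>{1..n}. x j \<noteq> u j}" by auto
    note lt[unfolded this]
    also note hamming_le_word_dist
    finally show "ereal d < word_dist G n x u" .
  qed
  have "independent_set (power_graph G n d) (?good \<union> ?P)"
    unfolding independent_set_power_graph_iff
  proof (intro conjI ballI impI)
    show "?good \<union> ?P \<subseteq> words G n" using UW PW by auto
    fix x x' assume x: "x \<in> ?good \<union> ?P" and x': "x' \<in> ?good \<union> ?P" and ne: "x \<noteq> x'"
    show "ereal d < word_dist G n x x'"
      using x x'
    proof (elim UnE)
      assume "x \<in> ?good" "x' \<in> ?good"
      then show ?thesis using U ne by (simp add: independent_set_power_graph_iff)
    next
      assume "x \<in> ?P" "x' \<in> ?P"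
      then show ?thesis using word_dist_PiE_independent[of n G J x x'] J ne by simp
    qed (use far in blast)+
  qed
  then have le: "card (?good \<union> ?P) \<le> card U"
    unfolding maxU by (rule card_le_independence_number[OF H])
  \<comment> \<open>A word of the product has no index outside the \<open>J j\<close>, and the count
    0 does not exceed \<open>d\<close>.\<close>
  have "?good \<inter> ?P = {}"
  proof -
    have "x \<notin> ?good" if "x \<in> ?P" for x
    proof -
      have empty: "{j\<in>{1..n}. x j \<notin> J j} = {}" using that by (auto simp: PiE_iff)
      show ?thesis unfolding mem_Collect_eq empty using d by simp
    qed
    then show ?thesis by blast
  qed
  moreover have finU: "finite U" and finP: "finite ?P"
    using UW PW finW by (auto intro: finite_subset)
  ultimately have "card ?good + card ?P \<le> card U"
    using le by (subst (asm) card_Un_disjoint) auto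
  moreover have "card U = card ?good + card ?bad"
    using finU by (subst card_Un_disjoint[symmetric]) (auto intro!: arg_cong[where f = card])
  ultimately show ?thesis by (simp add: card_PiE)
qed

text \<open>The Chernoff parameter \<open>s\<close> is kept free, and \<open>c\<close> stands for \<open>s\<^sup>d\<close>,
  so that \<open>s = 0\<close> (with \<open>d = 0\<close>) and \<open>s = 1\<close> need no separate treatment.\<close>

lemma independence_number_power_graph_ge:
  fixes G :: "'a ugraph" and c d s :: real
  assumes G: "fin_simple_graph G" and w: "fractional_colouring G w"
    and exact: "\<And>u. u \<in> verts G \<Longrightarrow> (\<Sum>I | independent_set G I \<and> u \<in> I. w I) = 1"
    and d: "0 \<le> d" and s: "0 \<le> s"
    and c: "\<And>k::nat. real k \<le> d \<Longrightarrow> c \<le> s ^ k"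
    and c0: "0 \<le> c"
  shows "c * real (card (verts G)) ^ n \<le>
    real (independence_number (power_graph G n d)) * (1 + s * (colouring_weight G w - 1)) ^ n"
proof -
  let ?S = "{I. independent_set G I}"
  let ?T = "PiE {1..n} (\<lambda>_. ?S)"
  let ?W = "\<lambda>J :: nat \<Rightarrow> 'a set. \<Prod>j\<in>{1..n}. w (J j)"
  let ?m = "\<lambda>(J :: nat \<Rightarrow> 'a set) u. card {j\<in>{1..n}. u j \<notin> J j}"
  have fin: "finite ?S" using G by (rule finite_independent_sets)
  have finV: "finite (verts G)" using G by (simp add: fin_simple_graph_def)
  have H: "fin_simple_graph (power_graph G n d)"
    using G by (rule fin_simple_graph_power_graph)
  obtain U where U: "independent_set (power_graph G n d) U"
    "card U = independence_number (power_graph G n d)"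
    using independence_number_attained[OF H] .
  have UW: "U \<subseteq> words G n" using U by (simp add: independent_set_power_graph_iff)
  have finU: "finite U"
    using U(1) H by (auto simp: independent_set_def fin_simple_graph_def intro: finite_subset)
  have W0: "0 \<le> ?W J" if "J \<in> ?T" for J
    using that w by (intro prod_nonneg) (auto simp: fractional_colouring_def PiE_iff)
  have cover_eq: "(\<Sum>I | independent_set G I \<and> u \<in> I. w I)
      = (\<Sum>I\<in>?S. if u \<in> I then w I else 0)" for u
    by (rule sum.mono_neutral_cong_left) (use fin in auto)
  \<comment> \<open>Double counting; exactness is what gives equality with |V|. The weights are not
    normalised to a probability distribution, so all sums here carry a factor q per
    coordinate.\<close>
  have "(\<Sum>I\<in>?S. w I * real (card I)) = (\<Sum>I\<in>?S. \<Sum>u\<in>verts G. if u \<in> I then w I else 0)"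
  proof (rule sum.cong)
    fix I assume "I \<in> ?S"
    then have "verts G \<inter> I = I" by (auto simp: independent_set_def)
    then show "w I * real (card I) = (\<Sum>u\<in>verts G. if u \<in> I then w I else 0)"
      using finV by (simp add: sum.If_cases)
  qed simp
  also have "\<dots> = (\<Sum>u\<in>verts G. 1)"
    by (subst sum.swap) (simp add: exact flip: cover_eq)
  finally have mean_card: "(\<Sum>I\<in>?S. w I * real (card I)) = real (card (verts G))" by simp
  \<comment> \<open>By exactness the sets containing \<open>u\<close> have total weight 1, and the
    remaining ones q - 1; the latter are counted with factor \<open>s\<close>.\<close>
  have letter: "(\<Sum>I\<in>?S. w I * (if u \<in> I then 1 else s)) = 1 + s * (colouring_weight G w - 1)"
    if "u \<in> verts G" for u
  proof -
    have "(\<Sum>I\<in>?S. w I * (if u \<in> I then 1 else s))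
        = (\<Sum>I\<in>?S. s * w I + (1 - s) * (if u \<in> I then w I else 0))"
      by (intro sum.cong) (auto simp: algebra_simps)
    also have "\<dots> = s * colouring_weight G w + (1 - s) * (\<Sum>I\<in>?S. if u \<in> I then w I else 0)"
      by (simp add: sum.distrib sum_distrib_left colouring_weight_def)
    also have "\<dots> = 1 + s * (colouring_weight G w - 1)"
      using exact[OF that] by (simp add: cover_eq algebra_simps)
    finally show ?thesis .
  qed
  have "c * real (card (verts G)) ^ n = (\<Prod>j\<in>{1..n}. \<Sum>I\<in>?S. w I * real (card I)) * c"
    by (simp add: mean_card)
  also have "\<dots> = (\<Sum>J\<in>?T. ?W J * (\<Prod>j\<in>{1..n}. real (card (J j))) * c)"
    using fin by (subst prod_sum_PiE) (auto simp: prod.distrib sum_distrib_right)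
  also have "\<dots> \<le> (\<Sum>J\<in>?T. ?W J * (\<Sum>u\<in>U. s ^ ?m J u))"
  proof (rule sum_mono)
    fix J assume J: "J \<in> ?T"
    have "(\<Prod>j\<in>{1..n}. card (J j)) \<le> card {u\<in>U. real (?m J u) \<le> d}"
      using J by (intro prod_card_le_replaced[OF G d U]) (auto simp: PiE_iff)
    then have "(\<Prod>j\<in>{1..n}. real (card (J j))) * c \<le> real (card {u\<in>U. real (?m J u) \<le> d}) * c"
      using c0 by (intro mult_right_mono) (simp_all flip: of_nat_prod)
    also have "\<dots> = (\<Sum>u | u \<in> U \<and> real (?m J u) \<le> d. c)" by simp
    \<comment> \<open>Chernoff's step: \<open>s ^ m\<close> dominates \<open>c\<close> wherever the
      count \<open>m\<close> is at most \<open>d\<close>, and is nonnegative elsewhere, so the sum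
      can next be extended to all of \<open>U\<close>.\<close>
    also have "\<dots> \<le> (\<Sum>u | u \<in> U \<and> real (?m J u) \<le> d. s ^ ?m J u)"
      by (intro sum_mono c) simp
    also have "\<dots> \<le> (\<Sum>u\<in>U. s ^ ?m J u)"
      using finU s by (intro sum_mono2) auto
    finally show "?W J * (\<Prod>j\<in>{1..n}. real (card (J j))) * c \<le> ?W J * (\<Sum>u\<in>U. s ^ ?m J u)"
      using W0[OF J] by (simp add: mult.assoc mult_left_mono)
  qed
  also have "\<dots> = (\<Sum>u\<in>U. \<Sum>J\<in>?T. ?W J * s ^ ?m J u)"
    by (subst sum.swap) (simp add: sum_distrib_left)
  \<comment> \<open>For fixed \<open>u\<close> the summand is a product over coordinates, so the sum
    over tuples \<open>J\<close> factors into n copies of the one-letter sum.\<close>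
  also have "\<dots> = (\<Sum>u\<in>U. \<Sum>J\<in>?T. \<Prod>j\<in>{1..n}. w (J j) * (if u j \<in> J j then 1 else s))"
  proof (intro sum.cong refl)
    fix u J
    have "(\<Prod>j\<in>{1..n}. if u j \<in> J j then 1 else s) = s ^ ?m J u"
      by (simp add: prod.If_cases Int_def Compl_eq)
    then show "?W J * s ^ ?m J u = (\<Prod>j\<in>{1..n}. w (J j) * (if u j \<in> J j then 1 else s))"
      by (simp add: prod.distrib)
  qed
  also have "\<dots> = (\<Sum>u\<in>U. \<Prod>j\<in>{1..n}. \<Sum>I\<in>?S. w I * (if u j \<in> I then 1 else s))"
    using fin by (subst prod_sum_PiE) auto
  also have "\<dots> = (\<Sum>u\<in>U. \<Prod>j\<in>{1..n}. 1 + s * (colouring_weight G w - 1))"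
    using UW by (intro sum.cong prod.cong letter refl) (auto simp: words_def PiE_iff)
  also have "\<dots> = real (card U) * (1 + s * (colouring_weight G w - 1)) ^ n" by simp
  finally show ?thesis unfolding U(2) .
qed

text \<open>Here \<kappa> stands for s to the power \<delta>. Keeping it separate allows s = 0 with
  \<kappa> = 1 when \<delta> = 0, where \<open>0 powr 0\<close> would be 0.\<close>

lemma Rstar_ge:
  assumes G: "fin_simple_graph G" and ne: "verts G \<noteq> {}" and b: "1 < b" and \<delta>: "0 \<le> \<delta>"
    and s: "0 \<le> s" and \<kappa>: "0 < \<kappa>"
    and le: "\<And>n k::nat. real k \<le> \<delta> * real n \<Longrightarrow> \<kappa> ^ n \<le> s ^ k"
  shows "Rstar b G \<delta> \<ge>
    ereal (log b (real (card (verts G)) * \<kappa> / (1 + s * (fractional_chromatic_number G - 1))))"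
proof -
  let ?q = "fractional_chromatic_number G"
  let ?C = "real (card (verts G)) * \<kappa> / (1 + s * (?q - 1))"
  obtain w0 where w0: "fractional_colouring G w0" "colouring_weight G w0 = ?q"
    using fractional_chromatic_number_attained[OF G] by blast
  obtain w where w: "fractional_colouring G w" "colouring_weight G w = ?q"
    "\<And>u. u \<in> verts G \<Longrightarrow> (\<Sum>I | independent_set G I \<and> u \<in> I. w I) = 1"
    using fractional_colouring_exact[OF G w0(1)] unfolding w0(2)
    by (elim exE conjE) (rule that, blast+)
  have q: "1 \<le> ?q" using one_le_colouring_weight[OF G ne w(1)] w(2) by simp
  have D: "0 < 1 + s * (?q - 1)" using s q by (simp add: add_pos_nonneg)
  have V: "0 < real (card (verts G))"
    using G ne by (simp add: fin_simple_graph_def card_gt_0_iff)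
  have C: "0 < ?C" using V \<kappa> D by simp
  \<comment> \<open>The bound holds for each positive length, not just asymptotically. At n = 0 the
    factor \<open>1 / real n\<close> is 0 by convention, so that length is left out.\<close>
  have "log b ?C \<le> 1 / real n * log b (real (independence_number (power_graph G n (\<delta> * real n))))"
    if n: "0 < n" for n
  proof -
    let ?\<alpha> = "real (independence_number (power_graph G n (\<delta> * real n)))"
    have "\<kappa> ^ n * real (card (verts G)) ^ n \<le> ?\<alpha> * (1 + s * (?q - 1)) ^ n"
      using independence_number_power_graph_ge[OF G w(1,3), of "\<delta> * real n" s "\<kappa> ^ n" n]
        \<delta> s le \<kappa> by (simp add: w(2))
    then have pw: "?C ^ n \<le> ?\<alpha>"
      using D by (simp add: power_divide power_mult_distrib pos_divide_le_eq mult.commute)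
    have "real n * log b ?C = log b (?C ^ n)"
      using C by (simp add: log_nat_power)
    also have "\<dots> \<le> log b ?\<alpha>"
      using b pw zero_less_power[OF C, of n] by simp
    finally show ?thesis using n by (simp add: field_simps)
  qed
  then show ?thesis
    unfolding Rstar_def
    by (intro le_Limsup) (auto intro!: eventually_sequentiallyI[of 1])
qed

section \<open>Choice of the Chernoff parameter\<close>

theorem proposition3:
  fixes G :: "'a ugraph" and b \<delta> :: real
  assumes "1 < b"
    and "fin_simple_graph G"
    and "verts G \<noteq> {}"
    and "0 \<le> \<delta>" and "\<delta> \<le> 1"
  shows "Rstar b G \<delta> \<ge>
    ereal (log b (real (card (verts G)) / fractional_chromatic_number G)
           + R_GV b (fractional_chromatic_number G) \<delta>)"
proof -
  let ?q = "fractional_chromatic_number G" and ?V = "real (card (verts G))"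
  have q: "1 \<le> ?q"
    using fractional_chromatic_number_attained[OF assms(2)] one_le_colouring_weight[OF assms(2,3)]
    by metis
  have V: "0 < ?V"
    using assms(2,3) by (simp add: fin_simple_graph_def card_gt_0_iff)
  note bound = Rstar_ge[OF assms(2,3,1,4)]
  consider "1 - 1 / ?q \<le> \<delta>" | "\<delta> < 1 - 1 / ?q" "\<delta> = 0" | "\<delta> < 1 - 1 / ?q" "0 < \<delta>"
    using assms(4) by linarith
  then show ?thesis
  proof cases
    case 1
    \<comment> \<open>With s = 1 every element of \<open>U\<close> is counted fully, which leaves
      |V|/q.\<close>
    then show ?thesis using bound[of 1 1] by (simp add: R_GV_def)
  next
    case 2
    have "log b (?V / ?q) + log b ?q = log b ?V"
      using V q assms(1) by (simp add: log_divide)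
    \<comment> \<open>With s = 0 only the count 0 contributes, and the denominator becomes
      1.\<close>
    then show ?thesis
      using bound[of 0 1] 2 by (simp add: R_GV_def entropy_q_def)
  next
    case 3
    \<comment> \<open>This is the stationary point of s^\<delta> / (1 + s (q - 1)). The condition
      \<delta> < 1 - 1/q places it below 1.\<close>
    define s where "s = \<delta> / ((1 - \<delta>) * (?q - 1))"
    have "\<delta> * ?q < ?q - 1" using 3(1) q by (simp add: field_simps)
    moreover have "\<delta> < 1" using 3(1) q by (smt (verit) divide_nonneg_nonneg)
    moreover have "1 < ?q" using calculation 3(2) q by (smt (verit) mult_pos_pos)
    ultimately have \<delta>1: "0 < 1 - \<delta>" and q1: "0 < ?q - 1" and lt: "\<delta> < (1 - \<delta>) * (?q - 1)"
      by (auto simp: algebra_simps)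
    have s0: "0 < s" and s1: "s \<le> 1" using 3(2) \<delta>1 q1 lt by (auto simp: s_def)
    have "(s powr \<delta>) ^ n \<le> s ^ k" if "real k \<le> \<delta> * real n" for n k :: nat
    proof -
      have "(s powr \<delta>) ^ n = s powr (\<delta> * real n)"
        using s0 by (simp add: powr_powr flip: powr_realpow)
      \<comment> \<open>As 0 < s \<le> 1, the power decreases in the exponent, so k \<le> \<delta> n
        gives this direction.\<close>
      also have "\<dots> \<le> s powr real k" using s0 s1 that by (intro powr_mono') auto
      finally show ?thesis using s0 by (simp add: powr_realpow)
    qed
    then have "Rstar b G \<delta> \<ge> ereal (log b (?V * s powr \<delta> / (1 + s * (?q - 1))))"
      using s0 by (intro bound) auto
    moreover have "1 + s * (?q - 1) = 1 / (1 - \<delta>)"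
    proof -
      have "s * (?q - 1) = \<delta> / (1 - \<delta>)" using q1 by (simp add: s_def)
      then show ?thesis using \<delta>1 by (simp add: field_simps)
    qed
    moreover have "log b s = log b \<delta> - (log b (1 - \<delta>) + log b (?q - 1))"
      using \<delta>1 q1 3(2) by (simp add: s_def log_divide log_mult)
    ultimately have "Rstar b G \<delta> \<ge> ereal (log b ?V
        + \<delta> * (log b \<delta> - (log b (1 - \<delta>) + log b (?q - 1))) + log b (1 - \<delta>))"
      using V s0 \<delta>1 by (simp add: log_mult log_powr)
    moreover have "log b (?V / ?q) + R_GV b ?q \<delta> = log b ?V
        + \<delta> * (log b \<delta> - (log b (1 - \<delta>) + log b (?q - 1))) + log b (1 - \<delta>)"
      using V q 3(1) by (simp add: R_GV_def entropy_q_def log_divide algebra_simps)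
    ultimately show ?thesis by simp
  qed
qed

end
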